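(* Let $k_0,k_1,k_2,k_3,a,b,\theta\in\mathbb{R}$ with $k_0ab\neq0$, and let $$\psi(u,v)=k_0\Big(\frac{\cos\theta}{2ab}(a^2u^2-b^2v^2)+uv\sin\theta\Big)-ab(k_1u+k_2v+k_3).$$ Then the system $$u_{xt}=ab\sin\theta\,[u_x\psi(u,v)-k_2]-b^2\cos\theta\,[v_x\psi(u,v)+k_1]+k_0u,$$ $$v_{xt}=-a^2\cos\theta\,[u_x\psi(u,v)-k_2]-ab\sin\theta\,[v_x\psi(u,v)+k_1]+k_0v$$ describes pseudospherical surfaces, with associated functions $$f_{11}=\eta\big[a\sin(\tfrac\theta2)u_x-b\cos(\tfrac\theta2)v_x\big],\qquad f_{12}=\tfrac1\eta\big[b\cos(\tfrac\theta2)\psi_u(u,v)+a\sin(\tfrac\theta2)\psi_v(u,v)\big],$$ $$f_{21}=\eta^2,\qquad f_{22}=\tfrac{1}{\eta^2}k_0-ab\,\psi(u,v),$$ $$f_{31}=\eta\big[a\cos(\tfrac\theta2)u_x+b\sin(\tfrac\theta2)v_x\big],\qquad f_{32}=\tfrac1\eta\big[-b\sin(\tfrac\theta2)\psi_u(u,v)+a\cos(\tfrac\theta2)\psi_v(u,v)\big],$$ where $\eta\in\mathbb{R}$, $\eta\neq0$.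
   Context: Definition. A system of PDEs for $u(x,t),v(x,t)$ describes pseudospherical surfaces with associated functions $f_{ij}$, $1\le i\le 3$, $1\le j\le 2$, if the system is equivalent to (i.e. has exactly the same solutions $(u,v)$ as) the structure equations $d\omega_1=\omega_3\wedge\omega_2$, $d\omega_2=\omega_1\wedge\omega_3$, $d\omega_3=\omega_1\wedge\omega_2$ of a surface with Gaussian curvature $K=-1$, where $\omega_i=f_{i1}dx+f_{i2}dt$ and $f_{ij}$ are evaluated on $u,v$ and their derivatives, with $\omega_1\wedge\omega_2\neq0$, i.e. $f_{11}f_{22}-f_{12}f_{21}\ne 0$, for generic solutions (on a suitable nonempty open set); i.e. $f_{11}f_{22}-f_{12}f_{21}$, as a function of $(u,u_x,v,v_x)$, is nonzero up to a set of measure zero. *)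

theory Defs
  imports "HOL-Analysis.Analysis"
begin

definition partial1 :: "(real \<times> real \<Rightarrow> real) \<Rightarrow> real \<times> real \<Rightarrow> real" where
  "partial1 f p = deriv (\<lambda>s. f (s, snd p)) (fst p)"

definition partial2 :: "(real \<times> real \<Rightarrow> real) \<Rightarrow> real \<times> real \<Rightarrow> real" where
  "partial2 f p = deriv (\<lambda>s. f (fst p, s)) (snd p)"

text \<open>Functions of class \<open>C\<^sup>k\<close> on an open subset \<open>U\<close> of the plane.\<close>

primrec cont_diff_on :: "nat \<Rightarrow> (real \<times> real) set \<Rightarrow> (real \<times> real \<Rightarrow> real) \<Rightarrow> bool" where
  "cont_diff_on 0 U f \<longleftrightarrow> continuous_on U f"
| "cont_diff_on (Suc k) U f \<longleftrightarrow>
     f differentiable_on U \<and> cont_diff_on k U (partial1 f) \<and> cont_diff_on k U (partial2 f)"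

text \<open>Differential forms on the \<open>(x, t)\<close>-plane, as functions of a base point and of
  one (or two) tangent vectors. The exterior derivative is
  \<open>d\<omega>(X, Y) = X(\<omega>(Y)) - Y(\<omega>(X))\<close> for constant vector fields \<open>X\<close>, \<open>Y\<close>; it is meaningful
  only where the coefficients of \<open>\<omega>\<close> are differentiable.\<close>

type_synonym one_form = "real \<times> real \<Rightarrow> real \<times> real \<Rightarrow> real"
type_synonym two_form = "real \<times> real \<Rightarrow> real \<times> real \<Rightarrow> real \<times> real \<Rightarrow> real"

definition form_dx_dt :: "(real \<times> real \<Rightarrow> real) \<Rightarrow> (real \<times> real \<Rightarrow> real) \<Rightarrow> one_form" where
  "form_dx_dt f g = (\<lambda>p X. f p * fst X + g p * snd X)"

definition wedge :: "one_form \<Rightarrow> one_form \<Rightarrow> two_form" where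
  "wedge \<omega> \<sigma> = (\<lambda>p X Y. \<omega> p X * \<sigma> p Y - \<omega> p Y * \<sigma> p X)"

definition ext_deriv :: "one_form \<Rightarrow> two_form" where
  "ext_deriv \<omega> = (\<lambda>p X Y. frechet_derivative (\<lambda>q. \<omega> q Y) (at p) X
                         - frechet_derivative (\<lambda>q. \<omega> q X) (at p) Y)"

definition pss_structure_equations ::
    "one_form \<Rightarrow> one_form \<Rightarrow> one_form \<Rightarrow> (real \<times> real) set \<Rightarrow> bool" where
  "pss_structure_equations \<omega>1 \<omega>2 \<omega>3 U \<longleftrightarrow>
     (\<forall>p\<in>U. ext_deriv \<omega>1 p = wedge \<omega>3 \<omega>2 p
          \<and> ext_deriv \<omega>2 p = wedge \<omega>1 \<omega>3 p
          \<and> ext_deriv \<omega>3 p = wedge \<omega>1 \<omega>2 p)"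

text \<open>Associated functions are functions of \<open>(u, u\<^sub>x, v, v\<^sub>x)\<close>, in this order; \<open>on_jet\<close>
  evaluates such a function along a pair \<open>u(x, t)\<close>, \<open>v(x, t)\<close>.\<close>

type_synonym jet_fun = "real \<Rightarrow> real \<Rightarrow> real \<Rightarrow> real \<Rightarrow> real"

definition on_jet ::
    "jet_fun \<Rightarrow> (real \<times> real \<Rightarrow> real) \<Rightarrow> (real \<times> real \<Rightarrow> real) \<Rightarrow> real \<times> real \<Rightarrow> real" where
  "on_jet f u v p = f (u p) (partial1 u p) (v p) (partial1 v p)"

text \<open>A second-order system is given by the predicate \<open>E u v p\<close> saying that \<open>u\<close>, \<open>v\<close>
  satisfy its equations at the point \<open>p = (x, t)\<close>. Solutions are classical: \<open>C\<^sup>2\<close>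
  functions on an arbitrary open set. Since the equivalence is stated pair by pair, it
  restricts to smooth solutions, or to any other subclass of \<open>C\<^sup>2\<close>.\<close>

definition describes_pss ::
    "((real \<times> real \<Rightarrow> real) \<Rightarrow> (real \<times> real \<Rightarrow> real) \<Rightarrow> real \<times> real \<Rightarrow> bool) \<Rightarrow>
     jet_fun \<Rightarrow> jet_fun \<Rightarrow> jet_fun \<Rightarrow> jet_fun \<Rightarrow> jet_fun \<Rightarrow> jet_fun \<Rightarrow> bool" where
  "describes_pss E f11 f12 f21 f22 f31 f32 \<longleftrightarrow>
     (\<forall>U u v. open U \<longrightarrow> cont_diff_on 2 U u \<longrightarrow> cont_diff_on 2 U v \<longrightarrow>
        ((\<forall>p\<in>U. E u v p) \<longleftrightarrow>
         pss_structure_equations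
           (form_dx_dt (on_jet f11 u v) (on_jet f12 u v))
           (form_dx_dt (on_jet f21 u v) (on_jet f22 u v))
           (form_dx_dt (on_jet f31 u v) (on_jet f32 u v)) U))
     \<and> negligible {(u, ux, v, vx). f11 u ux v vx * f22 u ux v vx
                                  - f12 u ux v vx * f21 u ux v vx = 0}"

end

theory Submission
  imports Defs
begin

text \<open>
  Everything becomes transparent in the coordinates obtained from \<open>(a u, b v)\<close> by a rotation
  by the half angle,
  \<open>P = a sin(\<theta>/2) u - b cos(\<theta>/2) v\<close> and \<open>R = a cos(\<theta>/2) u + b sin(\<theta>/2) v\<close>.
  Rotating by \<open>\<theta>/2\<close> diagonalises the quadratic part of \<open>\<psi>\<close>, because
  \<open>R\<^sup>2 - P\<^sup>2 = (a\<^sup>2 u\<^sup>2 - b\<^sup>2 v\<^sup>2) cos \<theta> + 2 a b u v sin \<theta>\<close>. With suitable constants \<open>\<kappa>\<close>, \<open>\<mu>\<close>,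
  \<open>\<nu>\<close> this separates the variables:
  \<open>a b \<psi> = (k\<^sub>0 R\<^sup>2 / 2 - \<kappa> R) - (k\<^sub>0 P\<^sup>2 / 2 - \<mu> P) + \<nu>\<close>.
  The associated functions are then
  \<open>f\<^sub>1\<^sub>1 = \<eta> P\<^sub>x\<close>, \<open>f\<^sub>1\<^sub>2 = (k\<^sub>0 R - \<kappa>) / \<eta>\<close>, \<open>f\<^sub>3\<^sub>1 = \<eta> R\<^sub>x\<close>, \<open>f\<^sub>3\<^sub>2 = (k\<^sub>0 P - \<mu>) / \<eta>\<close>, and
  up to sign the functions \<open>f\<^sub>1\<^sub>2\<close>, \<open>f\<^sub>3\<^sub>2\<close> are the partial derivatives of \<open>a b \<psi>\<close> with
  respect to \<open>R\<close> and \<open>P\<close>, divided by \<open>\<eta>\<close>.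

  Consequently the equation for \<open>d\<omega>\<^sub>2\<close> is the chain rule for \<open>\<psi>\<close> and holds for all \<open>u\<close>, \<open>v\<close>,
  while in the equations for \<open>d\<omega>\<^sub>1\<close> and \<open>d\<omega>\<^sub>3\<close> the terms with \<open>1/\<eta>\<close> cancel and what remains is
  \<open>P\<^sub>x\<^sub>t = a b \<psi> R\<^sub>x + k\<^sub>0 P - \<mu>\<close> and \<open>R\<^sub>x\<^sub>t = a b \<psi> P\<^sub>x + k\<^sub>0 R - \<kappa>\<close>
  (lemma \<open>structure_equations_rotated\<close>). The given system in \<open>u\<close>, \<open>v\<close> is this pair of equations
  under the linear change of coordinates, whose determinant \<open>a b\<close> is nonzero.

  For the non-degeneracy condition, \<open>f\<^sub>1\<^sub>1 f\<^sub>2\<^sub>2 - f\<^sub>1\<^sub>2 f\<^sub>2\<^sub>1\<close> is a cubic polynomial in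
  \<open>(u, u\<^sub>x, v, v\<^sub>x)\<close> with leading part \<open>-\<eta> k\<^sub>0 P\<^sub>x (R\<^sup>2 - P\<^sup>2) / 2\<close>. On each line in the direction
  that moves \<open>P\<^sub>x\<close> and \<open>R\<close> at equal speed and fixes \<open>P\<close> and \<open>R\<^sub>x\<close>, it is a polynomial of exact
  degree three in the parameter, so it has finitely many zeros there, and a Borel set that
  meets all lines parallel to a given direction in null sets is a null set
  (lemma \<open>negligible_if_negligible_on_parallel_lines\<close>).
\<close>

section \<open>Partial derivatives and the structure equations in coefficients\<close>

text \<open>
  The exterior derivative is built from Frechet derivatives and the equations of the system
  from partial derivatives along the axes; this is the bridge between them.
\<close>

lemma has_derivative_partials:
  assumes "f differentiable at p"
  shows "(f has_derivative (\<lambda>X. partial1 f p * fst X + partial2 f p * snd X)) (at p)"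
proof -
  from assms obtain D where D: "(f has_derivative D) (at p)"
    by (auto simp: differentiable_def)
  interpret D: bounded_linear D
    using D by (rule has_derivative_bounded_linear)
  have D': "(f has_derivative D) (at (fst p, snd p))"
    using D by simp
  have "((\<lambda>s. f (s, snd p)) has_derivative (\<lambda>h. D (h, 0))) (at (fst p))"
    by (rule has_derivative_compose[where g = f and f = "\<lambda>s. (s, snd p)", OF _ D'])
      (auto intro!: derivative_eq_intros)
  moreover have D1: "(\<lambda>h. D (h, 0)) = (*) (D (1, 0))"
  proof
    show "D (h, 0) = D (1, 0) * h" for h
      using D.scaleR[of h "(1, 0)"] by simp
  qed
  ultimately have p1: "partial1 f p = D (1, 0)"
    unfolding partial1_def by (intro DERIV_imp_deriv) (simp only: has_field_derivative_def)
  have "((\<lambda>s. f (fst p, s)) has_derivative (\<lambda>h. D (0, h))) (at (snd p))"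
    by (rule has_derivative_compose[where g = f and f = "\<lambda>s. (fst p, s)", OF _ D'])
      (auto intro!: derivative_eq_intros)
  moreover have D2: "(\<lambda>h. D (0, h)) = (*) (D (0, 1))"
  proof
    show "D (0, h) = D (0, 1) * h" for h
      using D.scaleR[of h "(0, 1)"] by simp
  qed
  ultimately have p2: "partial2 f p = D (0, 1)"
    unfolding partial2_def by (intro DERIV_imp_deriv) (simp only: has_field_derivative_def)
  have "D X = partial1 f p * fst X + partial2 f p * snd X" for X
    using D.add[of "(fst X, 0)" "(0, snd X)"] fun_cong[OF D1, of "fst X"]
      fun_cong[OF D2, of "snd X"] by (simp add: p1 p2)
  then have "D = (\<lambda>X. partial1 f p * fst X + partial2 f p * snd X)"
    by (rule ext)
  with D show ?thesis by simp
qed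

lemma partials_eqI:
  assumes "(f has_derivative D) (at p)"
  shows "partial1 f p = D (1, 0)" and "partial2 f p = D (0, 1)"
proof -
  have "(\<lambda>X. partial1 f p * fst X + partial2 f p * snd X) = D"
    using assms has_derivative_partials has_derivative_unique
    by (metis differentiableI)
  then show "partial1 f p = D (1, 0)" and "partial2 f p = D (0, 1)"
    by auto
qed

lemma ext_deriv_form_dx_dt:
  assumes f: "f differentiable at p" and g: "g differentiable at p"
  shows "ext_deriv (form_dx_dt f g) p =
    (\<lambda>X Y. (partial1 g p - partial2 f p) * (fst X * snd Y - fst Y * snd X))"
proof -
  have "frechet_derivative (\<lambda>q. form_dx_dt f g q Y) (at p) =
      (\<lambda>X. (partial1 f p * fst X + partial2 f p * snd X) * fst Y
         + (partial1 g p * fst X + partial2 g p * snd X) * snd Y)" for Y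
    unfolding form_dx_dt_def
    by (rule frechet_derivative_at[symmetric])
      (auto intro!: derivative_eq_intros has_derivative_partials[OF f] has_derivative_partials[OF g])
  then show ?thesis
    by (simp add: ext_deriv_def fun_eq_iff algebra_simps)
qed

lemma wedge_form_dx_dt:
  "wedge (form_dx_dt f g) (form_dx_dt f' g') p =
    (\<lambda>X Y. (f p * g' p - g p * f' p) * (fst X * snd Y - fst Y * snd X))"
  by (simp add: wedge_def form_dx_dt_def fun_eq_iff algebra_simps)

text \<open>
  An identity between two-forms on the plane is one scalar equation: evaluate on the standard
  basis.
\<close>

lemma area_form_multiple_eq_iff:
  fixes c d :: real
  shows "(\<lambda>X Y. c * (fst X * snd Y - fst Y * snd X)) =
    (\<lambda>X Y. d * (fst X * snd Y - fst Y * snd (X :: real \<times> real))) \<longleftrightarrow> c = d"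
  (is "?F = ?G \<longleftrightarrow> _")
proof
  assume "?F = ?G"
  then have "?F (1, 0) (0, 1) = ?G (1, 0) (0, 1)" by metis
  then show "c = d" by simp
qed simp

lemma pss_structure_equations_iff:
  assumes "\<And>p. p \<in> U \<Longrightarrow> f11 differentiable at p" "\<And>p. p \<in> U \<Longrightarrow> f12 differentiable at p"
    and "\<And>p. p \<in> U \<Longrightarrow> f21 differentiable at p" "\<And>p. p \<in> U \<Longrightarrow> f22 differentiable at p"
    and "\<And>p. p \<in> U \<Longrightarrow> f31 differentiable at p" "\<And>p. p \<in> U \<Longrightarrow> f32 differentiable at p"
  shows "pss_structure_equations (form_dx_dt f11 f12) (form_dx_dt f21 f22) (form_dx_dt f31 f32) U
    \<longleftrightarrow> (\<forall>p\<in>U. partial1 f12 p - partial2 f11 p = f31 p * f22 p - f32 p * f21 p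
             \<and> partial1 f22 p - partial2 f21 p = f11 p * f32 p - f12 p * f31 p
             \<and> partial1 f32 p - partial2 f31 p = f11 p * f22 p - f12 p * f21 p)"
  unfolding pss_structure_equations_def
  by (intro ball_cong refl)
    (simp add: assms ext_deriv_form_dx_dt wedge_form_dx_dt area_form_multiple_eq_iff)

section \<open>The system in rotated coordinates\<close>

text \<open>
  Here \<open>\<Psi>\<close> stands for \<open>a b \<psi>\<close>, and \<open>P1\<close>, \<open>R1\<close> for \<open>P\<^sub>x\<close>, \<open>R\<^sub>x\<close>. They are separate functions since
  the equality with the partial derivatives is known only on \<open>U\<close>. The form of \<open>\<Psi>\<close>, a function
  of \<open>R\<close> minus a function of \<open>P\<close>, is what makes the second structure equation an identity:
  \<open>\<Psi>\<^sub>x = (k R - \<kappa>) R\<^sub>x - (k P - \<mu>) P\<^sub>x\<close>. The summand \<open>k / \<eta>\<^sup>2\<close> of \<open>f\<^sub>2\<^sub>2\<close> is the one whose products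
  with \<open>\<eta> R\<^sub>x\<close> and \<open>\<eta> P\<^sub>x\<close> cancel the \<open>x\<close>-derivatives of \<open>f\<^sub>1\<^sub>2\<close> and \<open>f\<^sub>3\<^sub>2\<close>, so that the
  parameter \<open>\<eta>\<close> disappears from the compatibility conditions.
\<close>

lemma structure_equations_rotated:
  fixes P R P1 R1 :: "real \<times> real \<Rightarrow> real" and k \<kappa> \<mu> \<nu> \<eta> :: real
  defines "\<Psi> \<equiv> \<lambda>q. (k / 2 * (R q)\<^sup>2 - \<kappa> * R q) - (k / 2 * (P q)\<^sup>2 - \<mu> * P q) + \<nu>"
  assumes P: "\<And>p. p \<in> U \<Longrightarrow> P differentiable at p" and R: "\<And>p. p \<in> U \<Longrightarrow> R differentiable at p"
    and P1: "\<And>p. p \<in> U \<Longrightarrow> P1 differentiable at p" and R1: "\<And>p. p \<in> U \<Longrightarrow> R1 differentiable at p"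
    and Px: "\<And>p. p \<in> U \<Longrightarrow> partial1 P p = P1 p" and Rx: "\<And>p. p \<in> U \<Longrightarrow> partial1 R p = R1 p"
    and \<eta>: "\<eta> \<noteq> 0"
  shows "pss_structure_equations
      (form_dx_dt (\<lambda>q. \<eta> * P1 q) (\<lambda>q. 1 / \<eta> * (k * R q - \<kappa>)))
      (form_dx_dt (\<lambda>q. \<eta>\<^sup>2) (\<lambda>q. 1 / \<eta>\<^sup>2 * k - \<Psi> q))
      (form_dx_dt (\<lambda>q. \<eta> * R1 q) (\<lambda>q. 1 / \<eta> * (k * P q - \<mu>))) U
    \<longleftrightarrow> (\<forall>p\<in>U. partial2 P1 p = \<Psi> p * R1 p + k * P p - \<mu>
             \<and> partial2 R1 p = \<Psi> p * P1 p + k * R p - \<kappa>)"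
proof -
  note D = has_derivative_partials[OF P] has_derivative_partials[OF R]
    has_derivative_partials[OF P1] has_derivative_partials[OF R1]
  have d1: "((\<lambda>q. \<eta> * P1 q) has_derivative
      (\<lambda>X. \<eta> * (partial1 P1 p * fst X + partial2 P1 p * snd X))) (at p)"
    if "p \<in> U" for p
    by (intro has_derivative_mult_right D that)
  have d2: "((\<lambda>q. 1 / \<eta> * (k * R q - \<kappa>)) has_derivative
      (\<lambda>X. 1 / \<eta> * (k * (partial1 R p * fst X + partial2 R p * snd X)))) (at p)"
    if "p \<in> U" for p
    by (auto intro!: derivative_eq_intros D that simp: \<eta> fun_eq_iff field_simps)
  have d3: "((\<lambda>q. 1 / \<eta>\<^sup>2 * k - \<Psi> q) has_derivative
      (\<lambda>X. (k * P p - \<mu>) * (partial1 P p * fst X + partial2 P p * snd X)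
        - (k * R p - \<kappa>) * (partial1 R p * fst X + partial2 R p * snd X))) (at p)"
    if "p \<in> U" for p
    unfolding \<Psi>_def
    by (auto intro!: derivative_eq_intros D that simp: \<eta> fun_eq_iff field_simps)
  have d4: "((\<lambda>q. \<eta> * R1 q) has_derivative
      (\<lambda>X. \<eta> * (partial1 R1 p * fst X + partial2 R1 p * snd X))) (at p)"
    if "p \<in> U" for p
    by (intro has_derivative_mult_right D that)
  have d5: "((\<lambda>q. 1 / \<eta> * (k * P q - \<mu>)) has_derivative
      (\<lambda>X. 1 / \<eta> * (k * (partial1 P p * fst X + partial2 P p * snd X)))) (at p)"
    if "p \<in> U" for p
    by (auto intro!: derivative_eq_intros D that simp: \<eta> fun_eq_iff field_simps)
  have d6: "((\<lambda>q. \<eta>\<^sup>2) has_derivative (\<lambda>X. 0)) (at p :: (real \<times> real) filter)"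
    for p
    by (rule has_derivative_const)
  note diffs = d1[THEN differentiableI] d2[THEN differentiableI] d3[THEN differentiableI]
    d4[THEN differentiableI] d5[THEN differentiableI]
  have "pss_structure_equations
      (form_dx_dt (\<lambda>q. \<eta> * P1 q) (\<lambda>q. 1 / \<eta> * (k * R q - \<kappa>)))
      (form_dx_dt (\<lambda>q. \<eta>\<^sup>2) (\<lambda>q. 1 / \<eta>\<^sup>2 * k - \<Psi> q))
      (form_dx_dt (\<lambda>q. \<eta> * R1 q) (\<lambda>q. 1 / \<eta> * (k * P q - \<mu>))) U
    \<longleftrightarrow> (\<forall>p\<in>U. 1 / \<eta> * (k * R1 p) - \<eta> * partial2 P1 p
              = \<eta> * R1 p * (1 / \<eta>\<^sup>2 * k - \<Psi> p) - 1 / \<eta> * (k * P p - \<mu>) * \<eta>\<^sup>2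
          \<and> (k * P p - \<mu>) * P1 p - (k * R p - \<kappa>) * R1 p
              = \<eta> * P1 p * (1 / \<eta> * (k * P p - \<mu>)) - 1 / \<eta> * (k * R p - \<kappa>) * (\<eta> * R1 p)
          \<and> 1 / \<eta> * (k * P1 p) - \<eta> * partial2 R1 p
              = \<eta> * P1 p * (1 / \<eta>\<^sup>2 * k - \<Psi> p) - 1 / \<eta> * (k * R p - \<kappa>) * \<eta>\<^sup>2)"
    by (rule trans[OF pss_structure_equations_iff],
        (erule diffs | rule d6[THEN differentiableI])+, intro ball_cong refl)
      (simp add: partials_eqI[OF d1] partials_eqI[OF d2] partials_eqI[OF d3]
          partials_eqI[OF d4] partials_eqI[OF d5] partials_eqI[OF d6] Px Rx
        del: times_divide_eq_left times_divide_eq_right mult_1_left)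
  also have "\<dots> \<longleftrightarrow> (\<forall>p\<in>U. partial2 P1 p = \<Psi> p * R1 p + k * P p - \<mu>
             \<and> partial2 R1 p = \<Psi> p * P1 p + k * R p - \<kappa>)"
  proof (rule ball_cong[OF refl])
    fix p
    \<comment> \<open>The first and the third equation are this one, the latter with the roles of \<open>P\<close> and \<open>R\<close> exchanged.\<close>
    have cancel: "1 / \<eta> * (k * x) - \<eta> * y = \<eta> * x * (1 / \<eta>\<^sup>2 * k - w) - 1 / \<eta> * z * \<eta>\<^sup>2
        \<longleftrightarrow> y = w * x + z" for x y z w
    proof -
      have "1 / \<eta> * (k * x) - \<eta> * y - (\<eta> * x * (1 / \<eta>\<^sup>2 * k - w) - 1 / \<eta> * z * \<eta>\<^sup>2)
          = \<eta> * (w * x + z - y)"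
        using \<eta> by (simp add: field_simps power2_eq_square)
      then show ?thesis using \<eta>
        by (metis eq_iff_diff_eq_0 mult_eq_0_iff)
    qed
    show "(1 / \<eta> * (k * R1 p) - \<eta> * partial2 P1 p
              = \<eta> * R1 p * (1 / \<eta>\<^sup>2 * k - \<Psi> p) - 1 / \<eta> * (k * P p - \<mu>) * \<eta>\<^sup>2
          \<and> (k * P p - \<mu>) * P1 p - (k * R p - \<kappa>) * R1 p
              = \<eta> * P1 p * (1 / \<eta> * (k * P p - \<mu>)) - 1 / \<eta> * (k * R p - \<kappa>) * (\<eta> * R1 p)
          \<and> 1 / \<eta> * (k * P1 p) - \<eta> * partial2 R1 p
              = \<eta> * P1 p * (1 / \<eta>\<^sup>2 * k - \<Psi> p) - 1 / \<eta> * (k * R p - \<kappa>) * \<eta>\<^sup>2)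
      \<longleftrightarrow> (partial2 P1 p = \<Psi> p * R1 p + k * P p - \<mu>
             \<and> partial2 R1 p = \<Psi> p * P1 p + k * R p - \<kappa>)"
      \<comment> \<open>The middle conjunct is left over; once \<open>\<eta>\<close> is cancelled its two sides agree.\<close>
      unfolding cancel using \<eta> by (simp add: algebra_simps)
  qed
  finally show ?thesis .
qed

lemma half_angle_rotation:
  fixes \<theta> :: real
  shows "cos (\<theta> / 2) * cos \<theta> + sin (\<theta> / 2) * sin \<theta> = cos (\<theta> / 2)"
    and "cos (\<theta> / 2) * sin \<theta> - sin (\<theta> / 2) * cos \<theta> = sin (\<theta> / 2)"
  using cos_diff[of \<theta> "\<theta> / 2"] sin_diff[of \<theta> "\<theta> / 2"] by (simp_all add: mult.commute)

section \<open>Sets that meet parallel lines in null sets\<close>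

text \<open>
  Apply Tonelli's theorem to \<open>W = {(p, t). p + t d \<in> Z}\<close>. For fixed \<open>p\<close> its section is the trace
  of \<open>Z\<close> on a line, so \<open>W\<close> is a null set; hence the section of \<open>W\<close> at some \<open>t\<close> is null as well,
  and that section is a translate of \<open>Z\<close>. Integrating over all of space and not over a
  complement of \<open>d\<close> avoids a change of coordinates.
\<close>

lemma negligible_if_negligible_on_parallel_lines:
  fixes Z :: "'a::euclidean_space set"
  assumes Z: "Z \<in> sets borel"
    and line: "\<And>p. negligible {t. p + t *\<^sub>R d \<in> Z}"
  shows "negligible Z"
proof -
  define W where "W = {(p, t). p + t *\<^sub>R d \<in> Z}"
  have W: "W \<in> sets (lborel \<Otimes>\<^sub>M lborel)"
  proof -
    have "(\<lambda>w :: 'a \<times> real. fst w + snd w *\<^sub>R d) \<in> borel_measurable borel"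
      by (intro borel_measurable_continuous_onI continuous_intros)
    then have "W \<in> sets borel"
      using measurable_sets[OF _ Z] by (force simp: W_def vimage_def case_prod_unfold)
    then show ?thesis
      by (metis lborel_prod sets_lborel)
  qed
  have "emeasure (lborel \<Otimes>\<^sub>M lborel) W = (\<integral>\<^sup>+ p. emeasure lborel (Pair p -` W) \<partial>lborel)"
    by (rule lborel.emeasure_pair_measure_alt[OF W])
  also have "\<dots> = (\<integral>\<^sup>+ p. 0 \<partial>(lborel :: 'a measure))"
  proof (rule nn_integral_cong)
    fix p :: 'a
    have "negligible (Pair p -` W)"
      using line[of p] by (simp add: W_def vimage_def)
    moreover have "Pair p -` W \<in> sets lborel"
      by (rule sets_Pair1[OF W])
    ultimately show "emeasure lborel (Pair p -` W) = 0"
      by (simp add: negligible_iff_emeasure0 emeasure_completion)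
  qed
  finally have "emeasure (lborel \<Otimes>\<^sub>M lborel) W = 0" by simp
  then have "(\<integral>\<^sup>+ t. emeasure lborel ((\<lambda>p. (p, t)) -` W) \<partial>lborel) = 0"
    using lborel_pair.emeasure_pair_measure_alt2[OF W] by simp
  then have "AE t in lborel. emeasure lborel ((\<lambda>p. (p, t)) -` W) = 0"
    using nn_integral_0_iff_AE[OF lborel_pair.measurable_emeasure_Pair2[OF W]] by simp
  then obtain t where t: "emeasure lborel ((\<lambda>p. (p, t)) -` W) = 0"
    using eventually_happens'[of "ae_filter (lborel :: real measure)"]
    by (auto simp: ae_filter_eq_bot_iff)
  have "(\<lambda>p. (p, t)) -` W \<in> null_sets lborel"
    using t sets_Pair2[OF W] by (simp add: null_sets_def)
  then have "negligible ((\<lambda>p. (p, t)) -` W)"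
    using negligible_iff_null_sets null_sets_completionI by blast
  then have "negligible ((+) (t *\<^sub>R d) ` ((\<lambda>p. (p, t)) -` W))"
    by (rule negligible_translation)
  moreover have "(+) (t *\<^sub>R d) ` ((\<lambda>p. (p, t)) -` W) = Z"
  proof -
    have "z \<in> (+) (t *\<^sub>R d) ` ((\<lambda>p. (p, t)) -` W)" if "z \<in> Z" for z
      using that by (intro image_eqI[of _ _ "z - t *\<^sub>R d"]) (auto simp: W_def)
    then show ?thesis by (auto simp: W_def add.commute)
  qed
  ultimately show ?thesis by simp
qed

lemma finite_zeros_linear_times_quadratic:
  fixes l0 l1 g0 g1 g2 h0 h1 :: real
  assumes "l1 * g2 \<noteq> 0"
  shows "finite {t. (l0 + l1 * t) * (g0 + g1 * t + g2 * t\<^sup>2) - (h0 + h1 * t) = 0}"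
proof -
  let ?p = "[:l0, l1:] * [:g0, g1, g2:] - [:h0, h1:]"
  have "coeff ?p 3 = l1 * g2"
    by (simp add: numeral_3_eq_3)
  with assms have "?p \<noteq> 0"
    by force
  then have "finite {t. poly ?p t = 0}"
    by (rule poly_roots_finite)
  then show ?thesis
    by (simp add: algebra_simps power2_eq_square)
qed

section \<open>The equivalence and the non-degeneracy condition\<close>

theorem corollary5p1:
  fixes k0 k1 k2 k3 a b \<theta> \<eta> :: real
    and \<psi> :: "real \<times> real \<Rightarrow> real"
  assumes "k0 * a * b \<noteq> 0"
    and "\<eta> \<noteq> 0"
    and psi: "\<And>u v. \<psi> (u, v) =
      k0 * (cos \<theta> / (2 * a * b) * (a^2 * u^2 - b^2 * v^2) + u * v * sin \<theta>)
      - a * b * (k1 * u + k2 * v + k3)"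
  shows "describes_pss
    (\<lambda>u v p.
       partial2 (partial1 u) p =
         a * b * sin \<theta> * (partial1 u p * \<psi> (u p, v p) - k2)
         - b^2 * cos \<theta> * (partial1 v p * \<psi> (u p, v p) + k1) + k0 * u p
     \<and> partial2 (partial1 v) p =
         - (a^2) * cos \<theta> * (partial1 u p * \<psi> (u p, v p) - k2)
         - a * b * sin \<theta> * (partial1 v p * \<psi> (u p, v p) + k1) + k0 * v p)
    (\<lambda>u ux v vx. \<eta> * (a * sin (\<theta> / 2) * ux - b * cos (\<theta> / 2) * vx))
    (\<lambda>u ux v vx. 1 / \<eta> * (b * cos (\<theta> / 2) * partial1 \<psi> (u, v)
                        + a * sin (\<theta> / 2) * partial2 \<psi> (u, v)))
    (\<lambda>u ux v vx. \<eta>^2)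
    (\<lambda>u ux v vx. 1 / \<eta>^2 * k0 - a * b * \<psi> (u, v))
    (\<lambda>u ux v vx. \<eta> * (a * cos (\<theta> / 2) * ux + b * sin (\<theta> / 2) * vx))
    (\<lambda>u ux v vx. 1 / \<eta> * (- b * sin (\<theta> / 2) * partial1 \<psi> (u, v)
                        + a * cos (\<theta> / 2) * partial2 \<psi> (u, v)))"
proof -
  define s where "s = sin (\<theta> / 2)"
  define c where "c = cos (\<theta> / 2)"
  define S where "S = sin \<theta>"
  define C where "C = cos \<theta>"
  have ab: "a \<noteq> 0" "b \<noteq> 0" "k0 \<noteq> 0" and \<eta>: "\<eta> \<noteq> 0"
    using assms by auto
  have sc: "s\<^sup>2 + c\<^sup>2 = 1"
    by (simp add: s_def c_def)
  have rot: "c * C + s * S = c" "c * S - s * C = s"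
    using half_angle_rotation[of \<theta>] by (simp_all add: s_def c_def S_def C_def)
  have C: "C = c\<^sup>2 - s\<^sup>2" and S: "S = 2 * s * c"
    using cos_double[of "\<theta> / 2"] sin_double[of "\<theta> / 2"] by (simp_all add: s_def c_def S_def C_def)
  define \<kappa> where "\<kappa> = a * b * (b * k1 * c + a * k2 * s)"
  define \<mu> where "\<mu> = a * b * (a * k2 * c - b * k1 * s)"
  define \<nu> where "\<nu> = - (a\<^sup>2 * b\<^sup>2 * k3)"

  \<comment> \<open>The gradient of \<open>\<psi>\<close>, scaled so that \<open>u\<close> and \<open>v\<close> enter only as \<open>a u\<close> and \<open>b v\<close>.\<close>
  have psi1: "b * partial1 \<psi> (u, v) = k0 * (a * u * C + b * v * S) - a * b\<^sup>2 * k1" for u v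
  proof -
    have "partial1 \<psi> (u, v) = k0 * (C / (2 * a * b) * (a\<^sup>2 * (2 * u)) + v * S) - a * b * k1"
      unfolding partial1_def fst_conv snd_conv psi S_def C_def
      by (rule DERIV_imp_deriv) (auto intro!: derivative_eq_intros simp: ab)
    then show ?thesis
      using ab by (simp add: field_simps power2_eq_square)
  qed
  have psi2: "a * partial2 \<psi> (u, v) = k0 * (a * u * S - b * v * C) - a\<^sup>2 * b * k2" for u v
  proof -
    have "partial2 \<psi> (u, v) = k0 * (C / (2 * a * b) * (- (b\<^sup>2 * (2 * v))) + u * S) - a * b * k2"
      unfolding partial2_def fst_conv snd_conv psi S_def C_def
      by (rule DERIV_imp_deriv) (auto intro!: derivative_eq_intros simp: ab)
    then show ?thesis
      using ab by (simp add: field_simps power2_eq_square)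
  qed
  have f12: "b * c * partial1 \<psi> (u, v) + a * s * partial2 \<psi> (u, v)
      = k0 * (a * c * u + b * s * v) - \<kappa>" for u v
  proof -
    have "b * c * partial1 \<psi> (u, v) + a * s * partial2 \<psi> (u, v)
        = c * (b * partial1 \<psi> (u, v)) + s * (a * partial2 \<psi> (u, v))"
      by (simp add: algebra_simps)
    also have "\<dots> = k0 * (a * (c * C + s * S) * u + b * (c * S - s * C) * v) - \<kappa>"
      unfolding psi1 psi2 \<kappa>_def by (simp add: algebra_simps power2_eq_square)
    finally show ?thesis unfolding rot .
  qed
  have f32: "- b * s * partial1 \<psi> (u, v) + a * c * partial2 \<psi> (u, v)
      = k0 * (a * s * u - b * c * v) - \<mu>" for u v
  proof -
    have "- b * s * partial1 \<psi> (u, v) + a * c * partial2 \<psi> (u, v)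
        = - s * (b * partial1 \<psi> (u, v)) + c * (a * partial2 \<psi> (u, v))"
      by (simp add: algebra_simps)
    also have "\<dots> = k0 * (a * (c * S - s * C) * u - b * (c * C + s * S) * v) - \<mu>"
      unfolding psi1 psi2 \<mu>_def by (simp add: algebra_simps power2_eq_square)
    finally show ?thesis unfolding rot .
  qed
  have ab_psi: "a * b * \<psi> (u, v) =
      (k0 / 2 * (a * c * u + b * s * v)\<^sup>2 - \<kappa> * (a * c * u + b * s * v))
    - (k0 / 2 * (a * s * u - b * c * v)\<^sup>2 - \<mu> * (a * s * u - b * c * v)) + \<nu>" for u v
  proof -
    have quad: "(a * c * u + b * s * v)\<^sup>2 - (a * s * u - b * c * v)\<^sup>2
        = C * (a\<^sup>2 * u\<^sup>2 - b\<^sup>2 * v\<^sup>2) + 2 * a * b * u * v * S"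
      unfolding C S by (simp add: algebra_simps power2_eq_square)
    have lin: "\<kappa> * (a * c * u + b * s * v) - \<mu> * (a * s * u - b * c * v)
        = a\<^sup>2 * b\<^sup>2 * (k1 * u + k2 * v) * (s\<^sup>2 + c\<^sup>2)"
      unfolding \<kappa>_def \<mu>_def by (simp add: algebra_simps power2_eq_square)
    have "a * b * \<psi> (u, v) = k0 / 2 * (C * (a\<^sup>2 * u\<^sup>2 - b\<^sup>2 * v\<^sup>2) + 2 * a * b * u * v * S)
        - a\<^sup>2 * b\<^sup>2 * (k1 * u + k2 * v) + \<nu>"
      unfolding psi C_def[symmetric] S_def[symmetric] \<nu>_def
      using ab by (simp add: field_simps power2_eq_square)
    also have "\<dots> = k0 / 2 * ((a * c * u + b * s * v)\<^sup>2 - (a * s * u - b * c * v)\<^sup>2)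
        - (\<kappa> * (a * c * u + b * s * v) - \<mu> * (a * s * u - b * c * v)) + \<nu>"
      unfolding quad lin sc by simp
    finally show ?thesis
      by (simp add: algebra_simps)
  qed

  show ?thesis
    unfolding describes_pss_def s_def[symmetric] c_def[symmetric] S_def[symmetric]
      C_def[symmetric] f12 f32
  proof (intro conjI allI impI)
    fix U and u v :: "real \<times> real \<Rightarrow> real"
    assume U: "open U" and u: "cont_diff_on 2 U u" and v: "cont_diff_on 2 U v"
    have du: "u differentiable at p" "partial1 u differentiable at p"
      and dv: "v differentiable at p" "partial1 v differentiable at p" if "p \<in> U" for p
      using u v that U by (auto simp: numeral_2_eq_2 differentiable_on_eq_differentiable_at)
    define P where "P = (\<lambda>q. a * s * u q - b * c * v q)"
    define R where "R = (\<lambda>q. a * c * u q + b * s * v q)"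
    define P1 where "P1 = (\<lambda>q. a * s * partial1 u q - b * c * partial1 v q)"
    define R1 where "R1 = (\<lambda>q. a * c * partial1 u q + b * s * partial1 v q)"
    have dP: "(P has_derivative (\<lambda>X. a * s * (partial1 u p * fst X + partial2 u p * snd X)
          - b * c * (partial1 v p * fst X + partial2 v p * snd X))) (at p)"
      and dR: "(R has_derivative (\<lambda>X. a * c * (partial1 u p * fst X + partial2 u p * snd X)
          + b * s * (partial1 v p * fst X + partial2 v p * snd X))) (at p)"
      and dP1: "(P1 has_derivative
          (\<lambda>X. a * s * (partial1 (partial1 u) p * fst X + partial2 (partial1 u) p * snd X)
          - b * c * (partial1 (partial1 v) p * fst X + partial2 (partial1 v) p * snd X))) (at p)"
      and dR1: "(R1 has_derivative
          (\<lambda>X. a * c * (partial1 (partial1 u) p * fst X + partial2 (partial1 u) p * snd X)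
          + b * s * (partial1 (partial1 v) p * fst X + partial2 (partial1 v) p * snd X))) (at p)"
      if "p \<in> U" for p
      unfolding P_def R_def P1_def R1_def
      by (intro derivative_intros has_derivative_partials du[OF that] dv[OF that])+
    let ?\<Psi> = "\<lambda>q. (k0 / 2 * (R q)\<^sup>2 - \<kappa> * R q) - (k0 / 2 * (P q)\<^sup>2 - \<mu> * P q) + \<nu>"
    have \<Psi>: "a * b * \<psi> (u q, v q) = ?\<Psi> q" for q
      unfolding ab_psi P_def R_def ..
    have "pss_structure_equations
        (form_dx_dt (\<lambda>q. \<eta> * P1 q) (\<lambda>q. 1 / \<eta> * (k0 * R q - \<kappa>)))
        (form_dx_dt (\<lambda>q. \<eta>\<^sup>2) (\<lambda>q. 1 / \<eta>\<^sup>2 * k0 - ?\<Psi> q))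
        (form_dx_dt (\<lambda>q. \<eta> * R1 q) (\<lambda>q. 1 / \<eta> * (k0 * P q - \<mu>))) U
      \<longleftrightarrow> (\<forall>p\<in>U. partial2 P1 p = ?\<Psi> p * R1 p + k0 * P p - \<mu>
               \<and> partial2 R1 p = ?\<Psi> p * P1 p + k0 * R p - \<kappa>)"
      by (rule structure_equations_rotated)
        (auto intro: differentiableI dP dR dP1 dR1
          simp: \<eta> partials_eqI[OF dP] partials_eqI[OF dR], auto simp: P1_def R1_def)
    also have "\<dots> \<longleftrightarrow> (\<forall>p\<in>U.
         partial2 (partial1 u) p =
           a * b * S * (partial1 u p * \<psi> (u p, v p) - k2)
           - b\<^sup>2 * C * (partial1 v p * \<psi> (u p, v p) + k1) + k0 * u p
       \<and> partial2 (partial1 v) p =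
           - (a\<^sup>2) * C * (partial1 u p * \<psi> (u p, v p) - k2)
           - a * b * S * (partial1 v p * \<psi> (u p, v p) + k1) + k0 * v p)"
    proof (rule ball_cong[OF refl])
      fix p assume p: "p \<in> U"
      \<comment> \<open>The right-hand sides \<open>A\<close>, \<open>B\<close> of the system are rotated like \<open>u\<close> and \<open>v\<close>.\<close>
      define A where "A = a * b * S * (partial1 u p * \<psi> (u p, v p) - k2)
           - b\<^sup>2 * C * (partial1 v p * \<psi> (u p, v p) + k1) + k0 * u p"
      define B where "B = - (a\<^sup>2) * C * (partial1 u p * \<psi> (u p, v p) - k2)
           - a * b * S * (partial1 v p * \<psi> (u p, v p) + k1) + k0 * v p"
      have "a * s * A - b * c * B
          = a * b * \<psi> (u p, v p) * (a * (c * C + s * S) * partial1 u p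
              + b * (c * S - s * C) * partial1 v p)
            + k0 * P p - a * b * (a * k2 * (c * C + s * S) - b * k1 * (c * S - s * C))"
        unfolding A_def B_def P_def by (simp add: algebra_simps power2_eq_square)
      then have PA: "a * s * A - b * c * B = ?\<Psi> p * R1 p + k0 * P p - \<mu>"
        unfolding rot \<Psi> R1_def \<mu>_def .
      have "a * c * A + b * s * B
          = a * b * \<psi> (u p, v p) * (a * (c * S - s * C) * partial1 u p
              - b * (c * C + s * S) * partial1 v p)
            + k0 * R p - a * b * (b * k1 * (c * C + s * S) + a * k2 * (c * S - s * C))"
        unfolding A_def B_def R_def by (simp add: algebra_simps power2_eq_square)
      then have RA: "a * c * A + b * s * B = ?\<Psi> p * P1 p + k0 * R p - \<kappa>"
        unfolding rot \<Psi> P1_def \<kappa>_def .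
      \<comment> \<open>Undo the rotation by its transpose; the scaling by \<open>a\<close> and \<open>b\<close> is invertible.\<close>
      have injective: "a * s * x - b * c * y = a * s * x' - b * c * y'
          \<and> a * c * x + b * s * y = a * c * x' + b * s * y' \<longleftrightarrow> x = x' \<and> y = y'" (is "?l \<longleftrightarrow> ?r")
        for x y x' y'
      proof
        assume ?l
        then have e: "a * s * x - b * c * y - (a * s * x' - b * c * y') = 0"
          "a * c * x + b * s * y - (a * c * x' + b * s * y') = 0"
          by simp_all
        have "a * (x - x') * (s\<^sup>2 + c\<^sup>2) = s * (a * s * x - b * c * y - (a * s * x' - b * c * y'))
            + c * (a * c * x + b * s * y - (a * c * x' + b * s * y'))"
          by (simp add: algebra_simps power2_eq_square)
        moreover have "b * (y - y') * (s\<^sup>2 + c\<^sup>2)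
          = s * (a * c * x + b * s * y - (a * c * x' + b * s * y'))
            - c * (a * s * x - b * c * y - (a * s * x' - b * c * y'))"
          by (simp add: algebra_simps power2_eq_square)
        ultimately show ?r
          using ab unfolding e sc by simp
      qed simp
      show "(partial2 P1 p = ?\<Psi> p * R1 p + k0 * P p - \<mu>
               \<and> partial2 R1 p = ?\<Psi> p * P1 p + k0 * R p - \<kappa>) \<longleftrightarrow>
        (partial2 (partial1 u) p =
           a * b * S * (partial1 u p * \<psi> (u p, v p) - k2)
           - b\<^sup>2 * C * (partial1 v p * \<psi> (u p, v p) + k1) + k0 * u p
       \<and> partial2 (partial1 v) p =
           - (a\<^sup>2) * C * (partial1 u p * \<psi> (u p, v p) - k2)
           - a * b * S * (partial1 v p * \<psi> (u p, v p) + k1) + k0 * v p)"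
        unfolding A_def[symmetric] B_def[symmetric] PA[symmetric] RA[symmetric]
        by (simp add: partials_eqI[OF dP1[OF p]] partials_eqI[OF dR1[OF p]] injective)
    qed
    finally show "(\<forall>p\<in>U.
         partial2 (partial1 u) p =
           a * b * S * (partial1 u p * \<psi> (u p, v p) - k2)
           - b\<^sup>2 * C * (partial1 v p * \<psi> (u p, v p) + k1) + k0 * u p
       \<and> partial2 (partial1 v) p =
           - (a\<^sup>2) * C * (partial1 u p * \<psi> (u p, v p) - k2)
           - a * b * S * (partial1 v p * \<psi> (u p, v p) + k1) + k0 * v p) \<longleftrightarrow>
      pss_structure_equations
       (form_dx_dt
         (on_jet (\<lambda>u ux v vx. \<eta> * (a * s * ux - b * c * vx)) u v)
         (on_jet (\<lambda>u ux v vx. 1 / \<eta> * (k0 * (a * c * u + b * s * v) - \<kappa>)) u v))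
       (form_dx_dt
         (on_jet (\<lambda>u ux v vx. \<eta>\<^sup>2) u v)
         (on_jet (\<lambda>u ux v vx. 1 / \<eta>\<^sup>2 * k0 - a * b * \<psi> (u, v)) u v))
       (form_dx_dt
         (on_jet (\<lambda>u ux v vx. \<eta> * (a * c * ux + b * s * vx)) u v)
         (on_jet (\<lambda>u ux v vx. 1 / \<eta> * (k0 * (a * s * u - b * c * v) - \<mu>)) u v)) U"
      unfolding on_jet_def \<Psi> P1_def R1_def P_def[THEN fun_cong, symmetric]
        R_def[THEN fun_cong, symmetric] by (rule sym)
  next
    define G where "G = (\<lambda>u v. 1 / \<eta>\<^sup>2 * k0 - a * b * \<psi> (u, v))"
    define H where "H = (\<lambda>u v. 1 / \<eta> * (k0 * (a * c * u + b * s * v) - \<kappa>) * \<eta>\<^sup>2)"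
    define F where "F = (\<lambda>(u, ux, v, vx). \<eta> * (a * s * ux - b * c * vx) * G u v - H u v)"
    \<comment> \<open>Along \<open>d = (b c, b s, a s, - a c)\<close> both \<open>R\<close> and \<open>P\<^sub>x\<close> grow at rate \<open>a b\<close> while \<open>P\<close> stays
      constant. So \<open>f\<^sub>1\<^sub>1\<close> is affine in \<open>t\<close> with slope \<open>\<eta> a b\<close>, \<open>f\<^sub>2\<^sub>2\<close> is quadratic with leading
      coefficient \<open>- k\<^sub>0 (a b)\<^sup>2 / 2\<close>, and \<open>f\<^sub>1\<^sub>2 f\<^sub>2\<^sub>1\<close> is affine.\<close>
    have "negligible {w. F w = 0}"
    proof (rule negligible_if_negligible_on_parallel_lines[where d = "(b * c, b * s, a * s, - a * c)"])
      have "closed {w. F w = 0}"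
        unfolding F_def G_def H_def psi case_prod_unfold
        by (intro closed_Collect_eq continuous_intros)
      then show "{w. F w = 0} \<in> sets borel" by simp
    next
      fix w :: "real \<times> real \<times> real \<times> real"
      obtain u ux v vx where w: "w = (u, ux, v, vx)"
        by (cases w)
      have "{t. w + t *\<^sub>R (b * c, b * s, a * s, - a * c) \<in> {w. F w = 0}} =
        {t. (\<eta> * (a * s * ux - b * c * vx) + \<eta> * a * b * t)
            * (G u v + (- (a * b) * (k0 * (a * c * u + b * s * v) - \<kappa>)) * t
               + (- (k0 / 2 * (a * b)\<^sup>2)) * t\<^sup>2)
          - (H u v + \<eta> * k0 * a * b * t) = 0}"
      proof -
        have R: "a * c * (u + t * (b * c)) + b * s * (v + t * (a * s))
            = a * c * u + b * s * v + a * b * t" for t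
        proof -
          have "a * c * (u + t * (b * c)) + b * s * (v + t * (a * s))
            = a * c * u + b * s * v + a * b * t * (s\<^sup>2 + c\<^sup>2)"
            by (simp add: algebra_simps power2_eq_square)
          then show ?thesis by (simp add: sc)
        qed
        have P: "a * s * (u + t * (b * c)) - b * c * (v + t * (a * s)) = a * s * u - b * c * v" for t
          by (simp add: algebra_simps)
        have P1: "a * s * (ux + t * (b * s)) - b * c * (vx + t * (- a * c))
            = a * s * ux - b * c * vx + a * b * t" for t
        proof -
          have "a * s * (ux + t * (b * s)) - b * c * (vx + t * (- a * c))
            = a * s * ux - b * c * vx + a * b * t * (s\<^sup>2 + c\<^sup>2)"
            by (simp add: algebra_simps power2_eq_square)
          then show ?thesis by (simp add: sc)
        qed
        have G: "G (u + t * (b * c)) (v + t * (a * s)) =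
            G u v + (- (a * b) * (k0 * (a * c * u + b * s * v) - \<kappa>)) * t
               + (- (k0 / 2 * (a * b)\<^sup>2)) * t\<^sup>2" for t
          unfolding G_def ab_psi R P by (simp add: algebra_simps power2_eq_square)
        have H: "H (u + t * (b * c)) (v + t * (a * s)) = H u v + \<eta> * k0 * a * b * t" for t
          unfolding H_def R using \<eta> by (simp add: field_simps power2_eq_square)
        have "F (w + t *\<^sub>R (b * c, b * s, a * s, - a * c)) =
          (\<eta> * (a * s * ux - b * c * vx) + \<eta> * a * b * t)
            * (G u v + (- (a * b) * (k0 * (a * c * u + b * s * v) - \<kappa>)) * t
               + (- (k0 / 2 * (a * b)\<^sup>2)) * t\<^sup>2)
          - (H u v + \<eta> * k0 * a * b * t)" for t
          unfolding w F_def scaleR_Pair add_Pair prod.case real_scaleR_def P1 G H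
          by (simp add: algebra_simps)
        then show ?thesis by simp
      qed
      moreover have "finite \<dots>"
        by (rule finite_zeros_linear_times_quadratic) (use ab \<eta> in simp)
      ultimately show "negligible {t. w + t *\<^sub>R (b * c, b * s, a * s, - a * c) \<in> {w. F w = 0}}"
        by (simp add: negligible_finite)
    qed
    then show "negligible {(u, ux, v, vx).
        \<eta> * (a * s * ux - b * c * vx) * (1 / \<eta>\<^sup>2 * k0 - a * b * \<psi> (u, v))
        - 1 / \<eta> * (k0 * (a * c * u + b * s * v) - \<kappa>) * \<eta>\<^sup>2 = 0}"
      by (simp add: F_def G_def H_def case_prod_unfold)
  qed
qed

end
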